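(* For every $n$ with $0<n<\omega$, there are continuum-many ($2^{\aleph_0}$) normal monomodal logics $L$ with $K4U_n\subseteq L\subseteq K4I_n$.
   Context: Monomodal formulas are built from countably many atoms $q_0,q_1,\dots$ using $\top,\neg,\vee,\Diamond$, with $\Box\varphi=\neg\Diamond\neg\varphi$. A normal modal logic is a set of formulas containing all propositional tautologies, $\Box(p\to q)\to(\Box p\to\Box q)$ and $\Diamond p\leftrightarrow\neg\Box\neg p$, closed under modus ponens, generalisation and uniform substitution. Define $$U_n=\bigvee_{i\le n}\Box\bigl(\Box q_i\to\bigvee_{j\le n,\,j\ne i}\Box q_j\bigr),\qquad I_n=\Bigl(\bigwedge_{i\le n}\Diamond q_i\Bigr)\to\bigvee_{i,j\le n,\,i\ne j}\Diamond\bigl(q_i\wedge(q_j\vee\Diamond q_j)\bigr).$$ $K4U_n$ (respectively $K4I_n$) is the smallest normal modal logic containing $\Diamond\Diamond p\to\Diamond p$ and $U_n$ (respectively $I_n$). *)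

theory Defs
  imports Main "HOL-Library.Equipollence"
begin

datatype fm = Atom nat | Top | Neg fm | Or fm fm | Dia fm

definition Bot :: fm where "Bot = Neg Top"
definition And :: "fm \<Rightarrow> fm \<Rightarrow> fm" where "And \<phi> \<psi> = Neg (Or (Neg \<phi>) (Neg \<psi>))"
definition Imp :: "fm \<Rightarrow> fm \<Rightarrow> fm" where "Imp \<phi> \<psi> = Or (Neg \<phi>) \<psi>"
definition Iff :: "fm \<Rightarrow> fm \<Rightarrow> fm" where "Iff \<phi> \<psi> = And (Imp \<phi> \<psi>) (Imp \<psi> \<phi>)"
definition Box :: "fm \<Rightarrow> fm" where "Box \<phi> = Neg (Dia (Neg \<phi>))"

(* Right-nested, with the neutral element innermost. *)
definition BigOr :: "fm list \<Rightarrow> fm" where "BigOr \<phi>s = foldr Or \<phi>s Bot"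
definition BigAnd :: "fm list \<Rightarrow> fm" where "BigAnd \<phi>s = foldr And \<phi>s Top"

primrec subst :: "(nat \<Rightarrow> fm) \<Rightarrow> fm \<Rightarrow> fm" where
  "subst \<sigma> (Atom k) = \<sigma> k"
| "subst \<sigma> Top = Top"
| "subst \<sigma> (Neg \<phi>) = Neg (subst \<sigma> \<phi>)"
| "subst \<sigma> (Or \<phi> \<psi>) = Or (subst \<sigma> \<phi>) (subst \<sigma> \<psi>)"
| "subst \<sigma> (Dia \<phi>) = Dia (subst \<sigma> \<phi>)"

(* Formulas beginning with a diamond are treated as additional propositional atoms, so
   modal instances of tautologies count as tautologies. *)
primrec prop_eval :: "(fm \<Rightarrow> bool) \<Rightarrow> fm \<Rightarrow> bool" where
  "prop_eval v (Atom k) \<longleftrightarrow> v (Atom k)"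
| "prop_eval v Top \<longleftrightarrow> True"
| "prop_eval v (Neg \<phi>) \<longleftrightarrow> \<not> prop_eval v \<phi>"
| "prop_eval v (Or \<phi> \<psi>) \<longleftrightarrow> prop_eval v \<phi> \<or> prop_eval v \<psi>"
| "prop_eval v (Dia \<phi>) \<longleftrightarrow> v (Dia \<phi>)"

definition tautology :: "fm \<Rightarrow> bool" where
  "tautology \<phi> \<longleftrightarrow> (\<forall>v. prop_eval v \<phi>)"

(* The letters p and q of the axioms are the atoms 0 and 1. *)
definition axiom_K :: fm where
  "axiom_K = Imp (Box (Imp (Atom 0) (Atom 1))) (Imp (Box (Atom 0)) (Box (Atom 1)))"

definition axiom_Dual :: fm where
  "axiom_Dual = Iff (Dia (Atom 0)) (Neg (Box (Neg (Atom 0))))"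

definition axiom_4 :: fm where
  "axiom_4 = Imp (Dia (Dia (Atom 0))) (Dia (Atom 0))"

definition normal_modal_logic :: "fm set \<Rightarrow> bool" where
  "normal_modal_logic L \<longleftrightarrow>
     (\<forall>\<phi>. tautology \<phi> \<longrightarrow> \<phi> \<in> L) \<and>
     axiom_K \<in> L \<and>
     axiom_Dual \<in> L \<and>
     (\<forall>\<phi> \<psi>. Imp \<phi> \<psi> \<in> L \<longrightarrow> \<phi> \<in> L \<longrightarrow> \<psi> \<in> L) \<and>
     (\<forall>\<phi>. \<phi> \<in> L \<longrightarrow> Box \<phi> \<in> L) \<and>
     (\<forall>\<phi> \<sigma>. \<phi> \<in> L \<longrightarrow> subst \<sigma> \<phi> \<in> L)"

definition smallest_nml :: "fm set \<Rightarrow> fm set" where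
  "smallest_nml \<Gamma> = \<Inter>{L. normal_modal_logic L \<and> \<Gamma> \<subseteq> L}"

definition U :: "nat \<Rightarrow> fm" where
  "U n = BigOr [Box (Imp (Box (Atom i)) (BigOr [Box (Atom j). j \<leftarrow> [0..<Suc n], j \<noteq> i])).
                i \<leftarrow> [0..<Suc n]]"

definition I :: "nat \<Rightarrow> fm" where
  "I n = Imp (BigAnd [Dia (Atom i). i \<leftarrow> [0..<Suc n]])
             (BigOr [Dia (And (Atom i) (Or (Atom j) (Dia (Atom j)))).
                     i \<leftarrow> [0..<Suc n], j \<leftarrow> [0..<Suc n], i \<noteq> j])"

definition K4U :: "nat \<Rightarrow> fm set" where "K4U n = smallest_nml {axiom_4, U n}"
definition K4I :: "nat \<Rightarrow> fm set" where "K4I n = smallest_nml {axiom_4, I n}"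

end

theory Submission
  imports Defs "HOL-Library.Countable"
begin

text \<open>
  A transitive frame validates \<open>I n\<close> when no point has \<open>n + 1\<close> pairwise incomparable successors,
  and it validates \<open>U n\<close> when no point has \<open>n + 1\<close> successors whose \<^emph>\<open>sets of successors\<close> are
  pairwise incomparable under inclusion.  So \<open>U n\<close> tolerates arbitrarily many incomparable
  successors as long as their successor sets form a chain, and continuum many logics fit into
  this gap.

  The witnesses are the frames \<open>acc m\<close>: an irreflexive descending chain of points
  \<open>Inl 0, Inl 1, \<dots>\<close>, together with infinitely many dead ends \<open>Inr j\<close> that become visible on the
  chain only from height \<open>m\<close> on.  Successor sets form a chain, so every \<open>U n\<close> with \<open>0 < n\<close> is
  valid.  For \<open>m > 0\<close>, \<open>Inl m\<close> is the only point of the chain that sees the dead ends \<open>Inr j\<close> while its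
  topmost chain successor \<open>Inl (m - 1)\<close> does not; together they are an infinite antichain of
  successors of \<open>Inl m\<close>.
  The height of a chain point is expressible by iterated diamonds, so for \<open>k \<ge> 2\<close> there is a
  weakened substitution instance \<open>width_at n k\<close> of \<open>I n\<close> which says that this does not happen at
  height \<open>k\<close>.  It belongs to \<open>K4I n\<close> outright and is valid in \<open>acc m\<close> iff \<open>m \<noteq> k\<close>
  (lemma \<open>valid_width_at_iff\<close>).

  Intersecting \<open>K4I n\<close> with the logic of \<open>{acc m | m \<in> A}\<close> therefore gives different logics for
  different sets \<open>A\<close> of numbers \<open>\<ge> 2\<close>.  They contain \<open>K4U n\<close> because \<open>K4U n \<subseteq> K4I n\<close>
  (lemma \<open>U_in_if_I_in\<close>): substituting for \<open>q\<^sub>i\<close> the \<open>i\<close>-th formula refuting \<open>U n\<close> turns \<open>I n\<close>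
  into \<open>U n\<close> modulo K4.  There cannot be more than continuum many logics, as there are only
  countably many formulas.
\<close>

section \<open>Reasoning inside a normal modal logic\<close>

lemma prop_eval_Bot [simp]: "\<not> prop_eval v Bot"
  by (simp add: Bot_def)

lemma prop_eval_And [simp]: "prop_eval v (And \<phi> \<psi>) \<longleftrightarrow> prop_eval v \<phi> \<and> prop_eval v \<psi>"
  by (simp add: And_def)

lemma prop_eval_Imp [simp]: "prop_eval v (Imp \<phi> \<psi>) \<longleftrightarrow> (prop_eval v \<phi> \<longrightarrow> prop_eval v \<psi>)"
  by (simp add: Imp_def)

lemma prop_eval_Iff [simp]: "prop_eval v (Iff \<phi> \<psi>) \<longleftrightarrow> (prop_eval v \<phi> \<longleftrightarrow> prop_eval v \<psi>)"
  by (auto simp add: Iff_def)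

lemma prop_eval_Box [simp]: "prop_eval v (Box \<phi>) \<longleftrightarrow> \<not> v (Dia (Neg \<phi>))"
  by (simp add: Box_def)

lemma prop_eval_BigOr [simp]: "prop_eval v (BigOr \<phi>s) \<longleftrightarrow> (\<exists>\<phi>\<in>set \<phi>s. prop_eval v \<phi>)"
  unfolding BigOr_def by (induction \<phi>s) auto

lemma prop_eval_BigAnd [simp]: "prop_eval v (BigAnd \<phi>s) \<longleftrightarrow> (\<forall>\<phi>\<in>set \<phi>s. prop_eval v \<phi>)"
  unfolding BigAnd_def by (induction \<phi>s) auto

lemma subst_connectives [simp]:
  "subst \<sigma> Bot = Bot"
  "subst \<sigma> (And \<phi> \<psi>) = And (subst \<sigma> \<phi>) (subst \<sigma> \<psi>)"
  "subst \<sigma> (Imp \<phi> \<psi>) = Imp (subst \<sigma> \<phi>) (subst \<sigma> \<psi>)"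
  "subst \<sigma> (Iff \<phi> \<psi>) = Iff (subst \<sigma> \<phi>) (subst \<sigma> \<psi>)"
  "subst \<sigma> (Box \<phi>) = Box (subst \<sigma> \<phi>)"
  by (simp_all add: Bot_def And_def Imp_def Iff_def Box_def)

lemma subst_BigOr [simp]: "subst \<sigma> (BigOr \<phi>s) = BigOr (map (subst \<sigma>) \<phi>s)"
  unfolding BigOr_def by (induction \<phi>s) auto

lemma subst_BigAnd [simp]: "subst \<sigma> (BigAnd \<phi>s) = BigAnd (map (subst \<sigma>) \<phi>s)"
  unfolding BigAnd_def by (induction \<phi>s) auto

lemma nml_mp: "normal_modal_logic L \<Longrightarrow> Imp \<phi> \<psi> \<in> L \<Longrightarrow> \<phi> \<in> L \<Longrightarrow> \<psi> \<in> L"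
  unfolding normal_modal_logic_def by blast

lemma nml_nec: "normal_modal_logic L \<Longrightarrow> \<phi> \<in> L \<Longrightarrow> Box \<phi> \<in> L"
  unfolding normal_modal_logic_def by blast

lemma nml_subst: "normal_modal_logic L \<Longrightarrow> \<phi> \<in> L \<Longrightarrow> subst \<sigma> \<phi> \<in> L"
  unfolding normal_modal_logic_def by blast

lemma nml_taut_consequence:
  assumes L: "normal_modal_logic L"
    and "set \<Gamma> \<subseteq> L"
    and "\<And>v. \<forall>\<gamma>\<in>set \<Gamma>. prop_eval v \<gamma> \<Longrightarrow> prop_eval v \<phi>"
  shows "\<phi> \<in> L"
  using assms(2,3)
proof (induction \<Gamma> arbitrary: \<phi>)
  case Nil
  then show ?case
    using L by (simp add: normal_modal_logic_def tautology_def)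
next
  case (Cons \<gamma> \<Gamma>)
  have "Imp \<gamma> \<phi> \<in> L"
    using Cons.prems by (intro Cons.IH) auto
  then show ?case
    using Cons.prems(1) nml_mp [OF L] by auto
qed

lemma nml_K: "normal_modal_logic L \<Longrightarrow> Imp (Box (Imp \<phi> \<psi>)) (Imp (Box \<phi>) (Box \<psi>)) \<in> L"
  using nml_subst [of L axiom_K "\<lambda>k. if k = 0 then \<phi> else \<psi>"]
  by (simp add: normal_modal_logic_def axiom_K_def)

text \<open>
  Diamond is primitive and box carries a double negation, so passing from a diamond to the box
  needs the duality axiom, although it looks like a definitional triviality.
\<close>
lemma nml_Dual: "normal_modal_logic L \<Longrightarrow> Iff (Dia \<phi>) (Neg (Box (Neg \<phi>))) \<in> L"
  using nml_subst [of L axiom_Dual "\<lambda>_. \<phi>"]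
  by (simp add: normal_modal_logic_def axiom_Dual_def)

lemma nml_Dia_mono:
  assumes L: "normal_modal_logic L" and "Imp \<phi> \<psi> \<in> L"
  shows "Imp (Dia \<phi>) (Dia \<psi>) \<in> L"
proof -
  have "Imp (Neg \<psi>) (Neg \<phi>) \<in> L"
    using assms(2) by (intro nml_taut_consequence [OF L, of "[Imp \<phi> \<psi>]"]) auto
  then have "Imp (Box (Neg \<psi>)) (Box (Neg \<phi>)) \<in> L"
    using nml_mp [OF L nml_K [OF L]] nml_nec [OF L] by blast
  then show ?thesis
    using nml_Dual [OF L, of \<phi>] nml_Dual [OF L, of \<psi>]
    by (intro nml_taut_consequence [OF L, of "[Imp (Box (Neg \<psi>)) (Box (Neg \<phi>)),
          Iff (Dia \<phi>) (Neg (Box (Neg \<phi>))), Iff (Dia \<psi>) (Neg (Box (Neg \<psi>)))]"]) auto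
qed

lemma nml_not_Dia:
  assumes L: "normal_modal_logic L" and "Neg \<phi> \<in> L"
  shows "Neg (Dia \<phi>) \<in> L"
  using nml_nec [OF L assms(2)] nml_Dual [OF L, of \<phi>]
  by (intro nml_taut_consequence [OF L, of "[Box (Neg \<phi>), Iff (Dia \<phi>) (Neg (Box (Neg \<phi>)))]"])
     auto

lemma nml_4:
  assumes "normal_modal_logic L" "axiom_4 \<in> L"
  shows "Imp (Dia (Dia \<phi>)) (Dia \<phi>) \<in> L"
  using nml_subst [OF assms, of "\<lambda>_. \<phi>"] by (simp add: axiom_4_def)

text \<open>
  Let \<open>\<chi> i\<close> say that \<open>q\<^sub>i\<close> is the only one of the atoms that is necessary.  The \<open>i\<close>-th disjunct of
  \<open>U n\<close> is by definition \<open>Neg (Dia (\<chi> i))\<close>, so \<open>U n\<close> negates the premise of the instance of \<open>I n\<close>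
  at \<open>\<chi>\<close>.  The conclusion of that instance is refutable in K4: \<open>\<chi> i\<close> contains \<open>\<box>q\<^sub>i\<close>, which is
  inherited by all successors, whereas \<open>\<chi> j\<close> contains its negation.
\<close>
lemma U_in_if_I_in:
  assumes L: "normal_modal_logic L" and "axiom_4 \<in> L" and "I n \<in> L"
  shows "U n \<in> L"
proof -
  define \<chi> where
    "\<chi> i = Neg (Imp (Box (Atom i)) (BigOr [Box (Atom j). j \<leftarrow> [0..<Suc n], j \<noteq> i]))" for i
  define C where "C i j = And (\<chi> i) (Or (\<chi> j) (Dia (\<chi> j)))" for i j
  have eval_\<chi>: "prop_eval v (\<chi> i) \<longleftrightarrow>
      \<not> v (Dia (Neg (Atom i))) \<and> (\<forall>j\<le>n. j \<noteq> i \<longrightarrow> v (Dia (Neg (Atom j))))" for v i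
    unfolding \<chi>_def by (auto simp del: upt_Suc simp: less_Suc_eq_le)
  have refutable: "Neg (Dia (C i j)) \<in> L" if "i \<le> n" "j \<le> n" "i \<noteq> j" for i j
  proof -
    have "Imp (\<chi> j) (Dia (Neg (Atom i))) \<in> L"
      using that by (intro nml_taut_consequence [OF L, of "[]"]) (auto simp: eval_\<chi>)
    then have "Imp (Dia (\<chi> j)) (Dia (Dia (Neg (Atom i)))) \<in> L"
      by (rule nml_Dia_mono [OF L])
    then have "Neg (C i j) \<in> L"
      using nml_4 [OF assms(1,2), of "Neg (Atom i)"] that
      by (intro nml_taut_consequence [OF L, of "[Imp (Dia (\<chi> j)) (Dia (Dia (Neg (Atom i)))),
            Imp (Dia (Dia (Neg (Atom i)))) (Dia (Neg (Atom i)))]"]) (auto simp: C_def eval_\<chi>)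
    then show ?thesis
      by (rule nml_not_Dia [OF L])
  qed
  let ?\<Gamma> = "subst \<chi> (I n) #
      [Neg (Dia (C i j)). i \<leftarrow> [0..<Suc n], j \<leftarrow> [0..<Suc n], i \<noteq> j]"
  have "set ?\<Gamma> \<subseteq> L"
    using refutable nml_subst [OF L \<open>I n \<in> L\<close>] by auto
  moreover have "prop_eval v (U n)" if "\<forall>\<gamma>\<in>set ?\<Gamma>. prop_eval v \<gamma>" for v
  proof -
    have U: "prop_eval v (U n) \<longleftrightarrow> (\<exists>i\<le>n. \<not> v (Dia (\<chi> i)))"
      unfolding U_def \<chi>_def by (auto simp del: upt_Suc simp: less_Suc_eq_le)
    have I: "prop_eval v (subst \<chi> (I n)) \<longleftrightarrow>
        ((\<forall>i\<le>n. v (Dia (\<chi> i))) \<longrightarrow> (\<exists>i\<le>n. \<exists>j\<le>n. i \<noteq> j \<and> v (Dia (C i j))))"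
      unfolding I_def C_def by (fastforce simp del: upt_Suc simp: less_Suc_eq_le)
    have "\<not> v (Dia (C i j))" if "i \<le> n" "j \<le> n" "i \<noteq> j" for i j
      using \<open>\<forall>\<gamma>\<in>set ?\<Gamma>. prop_eval v \<gamma>\<close> that by (fastforce simp del: upt_Suc simp: less_Suc_eq_le)
    moreover have "prop_eval v (subst \<chi> (I n))"
      using that by (simp del: upt_Suc)
    ultimately show ?thesis
      unfolding U I by blast
  qed
  ultimately show ?thesis
    by (rule nml_taut_consequence [OF L])
qed

lemma normal_modal_logic_Inter:
  "(\<And>L. L \<in> \<L> \<Longrightarrow> normal_modal_logic L) \<Longrightarrow> normal_modal_logic (\<Inter>\<L>)"
  unfolding normal_modal_logic_def by blast

lemma normal_modal_logic_smallest_nml: "normal_modal_logic (smallest_nml \<Gamma>)"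
  unfolding smallest_nml_def by (rule normal_modal_logic_Inter) simp

lemma smallest_nml_upper: "\<Gamma> \<subseteq> smallest_nml \<Gamma>"
  unfolding smallest_nml_def by blast

lemma smallest_nml_least: "normal_modal_logic L \<Longrightarrow> \<Gamma> \<subseteq> L \<Longrightarrow> smallest_nml \<Gamma> \<subseteq> L"
  unfolding smallest_nml_def by blast

lemma normal_modal_logic_K4I: "normal_modal_logic (K4I n)"
  by (simp add: K4I_def normal_modal_logic_smallest_nml)

lemma K4I_axioms: "axiom_4 \<in> K4I n" "I n \<in> K4I n"
  unfolding K4I_def using smallest_nml_upper by blast+

section \<open>Kripke semantics\<close>

primrec sat :: "('w \<Rightarrow> 'w \<Rightarrow> bool) \<Rightarrow> (nat \<Rightarrow> 'w \<Rightarrow> bool) \<Rightarrow> 'w \<Rightarrow> fm \<Rightarrow> bool" where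
  "sat R V w (Atom k) \<longleftrightarrow> V k w"
| "sat R V w Top \<longleftrightarrow> True"
| "sat R V w (Neg \<phi>) \<longleftrightarrow> \<not> sat R V w \<phi>"
| "sat R V w (Or \<phi> \<psi>) \<longleftrightarrow> sat R V w \<phi> \<or> sat R V w \<psi>"
| "sat R V w (Dia \<phi>) \<longleftrightarrow> (\<exists>u. R w u \<and> sat R V u \<phi>)"

definition valid :: "('w \<Rightarrow> 'w \<Rightarrow> bool) \<Rightarrow> fm \<Rightarrow> bool" where
  "valid R \<phi> \<longleftrightarrow> (\<forall>V w. sat R V w \<phi>)"

lemma sat_connectives [simp]:
  "\<not> sat R V w Bot"
  "sat R V w (And \<phi> \<psi>) \<longleftrightarrow> sat R V w \<phi> \<and> sat R V w \<psi>"
  "sat R V w (Imp \<phi> \<psi>) \<longleftrightarrow> (sat R V w \<phi> \<longrightarrow> sat R V w \<psi>)"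
  "sat R V w (Iff \<phi> \<psi>) \<longleftrightarrow> (sat R V w \<phi> \<longleftrightarrow> sat R V w \<psi>)"
  "sat R V w (Box \<phi>) \<longleftrightarrow> (\<forall>u. R w u \<longrightarrow> sat R V u \<phi>)"
  by (auto simp add: Bot_def And_def Imp_def Iff_def Box_def)

lemma sat_BigOr [simp]: "sat R V w (BigOr \<phi>s) \<longleftrightarrow> (\<exists>\<phi>\<in>set \<phi>s. sat R V w \<phi>)"
  unfolding BigOr_def by (induction \<phi>s) auto

lemma sat_BigAnd [simp]: "sat R V w (BigAnd \<phi>s) \<longleftrightarrow> (\<forall>\<phi>\<in>set \<phi>s. sat R V w \<phi>)"
  unfolding BigAnd_def by (induction \<phi>s) auto

lemma sat_subst: "sat R V w (subst \<sigma> \<phi>) \<longleftrightarrow> sat R (\<lambda>k u. sat R V u (\<sigma> k)) w \<phi>"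
  by (induction \<phi> arbitrary: w) auto

lemma sat_eq_prop_eval: "sat R V w \<phi> \<longleftrightarrow> prop_eval (sat R V w) \<phi>"
  by (induction \<phi>) auto

lemma normal_modal_logic_valid: "normal_modal_logic {\<phi>. valid R \<phi>}"
proof -
  have "valid R \<phi>" if "tautology \<phi>" for \<phi>
    using that by (simp add: tautology_def valid_def sat_eq_prop_eval)
  then show ?thesis
    unfolding normal_modal_logic_def
    by (auto simp: valid_def axiom_K_def axiom_Dual_def sat_subst)
qed

lemma valid_axiom_4: "transp R \<Longrightarrow> valid R axiom_4"
  by (auto simp: valid_def axiom_4_def dest: transpD)

lemma sat_U: "sat R V w (U n) \<longleftrightarrow>
    (\<exists>i\<le>n. \<forall>u. R w u \<longrightarrow> (\<forall>v. R u v \<longrightarrow> V i v) \<longrightarrow>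
       (\<exists>j\<le>n. j \<noteq> i \<and> (\<forall>v. R u v \<longrightarrow> V j v)))"
proof -
  have "set [Box (Atom j). j \<leftarrow> [0..<Suc n], j \<noteq> i] = (\<lambda>j. Box (Atom j)) ` {j. j \<le> n \<and> j \<noteq> i}" for i
    by (auto simp del: upt_Suc simp: less_Suc_eq_le)
  moreover have "(\<exists>i\<in>{0..<Suc n}. P i) \<longleftrightarrow> (\<exists>i\<le>n. P i)" for P
    by (auto simp: less_Suc_eq_le)
  ultimately show ?thesis
    by (simp add: U_def conj_assoc del: upt_Suc set_concat)
qed

lemma sat_I: "sat R V w (I n) \<longleftrightarrow>
    ((\<forall>i\<le>n. \<exists>u. R w u \<and> V i u) \<longrightarrow>
     (\<exists>i\<le>n. \<exists>j\<le>n. i \<noteq> j \<and> (\<exists>u. R w u \<and> V i u \<and> (V j u \<or> (\<exists>v. R u v \<and> V j v)))))"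
proof -
  have "set [Dia (And (Atom i) (Or (Atom j) (Dia (Atom j)))).
          i \<leftarrow> [0..<Suc n], j \<leftarrow> [0..<Suc n], i \<noteq> j] =
        (\<lambda>(i, j). Dia (And (Atom i) (Or (Atom j) (Dia (Atom j))))) ` {(i, j). i \<le> n \<and> j \<le> n \<and> i \<noteq> j}"
    by (force simp del: upt_Suc simp: less_Suc_eq_le image_iff Bex_def)
  moreover have "(\<forall>i\<in>{0..<Suc n}. P i) \<longleftrightarrow> (\<forall>i\<le>n. P i)" for P
    by (auto simp: less_Suc_eq_le)
  ultimately show ?thesis
    by (simp add: I_def conj_assoc del: upt_Suc set_concat)
qed

text \<open>
  Refuting \<open>U n\<close> takes \<open>n + 1 \<ge> 2\<close> points no two of which have comparable successor sets.
\<close>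
lemma valid_U_if_successors_chain:
  assumes chain: "\<And>x y. (\<forall>v. R x v \<longrightarrow> R y v) \<or> (\<forall>v. R y v \<longrightarrow> R x v)" and "0 < n"
  shows "valid R (U n)"
  unfolding valid_def
proof (intro allI, rule ccontr)
  fix V w
  assume "\<not> sat R V w (U n)"
  then have refuted: "\<not> (\<forall>u. R w u \<longrightarrow> (\<forall>v. R u v \<longrightarrow> V i v) \<longrightarrow>
      (\<exists>j\<le>n. j \<noteq> i \<and> (\<forall>v. R u v \<longrightarrow> V j v)))" if "i \<le> n" for i
    unfolding sat_U using that by simp
  have ex: "\<exists>x. (\<forall>v. R x v \<longrightarrow> V i v) \<and> \<not> (\<forall>v. R x v \<longrightarrow> V j v)"
    if "i \<le> n" "j \<le> n" "j \<noteq> i" for i j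
    using refuted [OF that(1)] that(2,3) by metis
  obtain x where x: "\<forall>v. R x v \<longrightarrow> V 0 v" "\<not> (\<forall>v. R x v \<longrightarrow> V n v)"
    using ex [of 0 n] \<open>0 < n\<close> by auto
  obtain y where y: "\<forall>v. R y v \<longrightarrow> V n v" "\<not> (\<forall>v. R y v \<longrightarrow> V 0 v)"
    using ex [of n 0] \<open>0 < n\<close> by auto
  from chain [of x y] show False
    using x y by metis
qed

section \<open>The frames\<close>

fun acc :: "nat \<Rightarrow> nat + nat \<Rightarrow> nat + nat \<Rightarrow> bool" where
  "acc m (Inl i) (Inl j) \<longleftrightarrow> j < i"
| "acc m (Inl i) (Inr j) \<longleftrightarrow> m \<le> i"
| "acc m (Inr i) y \<longleftrightarrow> False"

lemma transp_acc: "transp (acc m)"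
proof (rule transpI)
  fix x y z
  assume "acc m x y" "acc m y z"
  then show "acc m x z"
    by (cases x; cases y; cases z) auto
qed

lemma acc_successors_chain:
  "(\<forall>v. acc m x v \<longrightarrow> acc m y v) \<or> (\<forall>v. acc m y v \<longrightarrow> acc m x v)"
proof -
  have mono: "acc m (Inl j) v" if "i \<le> j" "acc m (Inl i) v" for i j v
    using that by (cases v) auto
  show ?thesis
  proof (cases x)
    case x: (Inl i)
    show ?thesis
    proof (cases y)
      case (Inl j)
      then show ?thesis using x mono [of i j] mono [of j i] linear [of i j] by blast
    qed simp
  qed simp
qed

lemma K4U_axioms_valid_acc:
  assumes "0 < n"
  shows "valid (acc m) axiom_4" "valid (acc m) (U n)"
  by (rule valid_axiom_4 [OF transp_acc])
     (rule valid_U_if_successors_chain [OF acc_successors_chain assms])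

section \<open>Formulas separating the frames\<close>

abbreviation reaches :: "nat \<Rightarrow> fm" where
  "reaches k \<equiv> (Dia ^^ k) Top"

lemma sat_reaches_Inr [simp]: "sat (acc m) V (Inr j) (reaches k) \<longleftrightarrow> k = 0"
  by (cases k) auto

text \<open>
  For \<open>m = 0\<close> this fails at \<open>Inl 0\<close>, which would not be a dead end.
\<close>
lemma sat_reaches_Inl:
  assumes "0 < m"
  shows "sat (acc m) V (Inl i) (reaches k) \<longleftrightarrow> k \<le> i"
proof (induction k arbitrary: i)
  case 0
  then show ?case by simp
next
  case (Suc k)
  show ?case
  proof
    assume "sat (acc m) V (Inl i) (reaches (Suc k))"
    then obtain u where u: "acc m (Inl i) u" "sat (acc m) V u (reaches k)"
      by auto
    show "Suc k \<le> i"
    proof (cases u)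
      case (Inl j)
      then show ?thesis using u Suc.IH by auto
    next
      case (Inr j)
      then show ?thesis using u assms by auto
    qed
  next
    assume "Suc k \<le> i"
    then show "sat (acc m) V (Inl i) (reaches (Suc k))"
      using Suc.IH[of k] by (auto intro!: exI[of _ "Inl k"])
  qed
qed

text \<open>
  The instance of \<open>I n\<close> is restricted so that a refuting antichain must contain a dead end and a
  point of height at least \<open>k - 1\<close>, and the first disjunct confines refutation to points of
  height at most \<open>k\<close>.
\<close>
definition width_at :: "nat \<Rightarrow> nat \<Rightarrow> fm" where
  "width_at n k = Or (reaches (Suc k))
     (subst (\<lambda>i. if i = 0 then And (Atom 0) (Box Bot)
                 else if i = n then And (Atom n) (reaches (k - 1))
                 else Atom i) (I n))"

lemma width_at_in_K4I: "width_at n k \<in> K4I n"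
  unfolding width_at_def
  by (rule nml_taut_consequence [OF normal_modal_logic_K4I, of "[subst \<sigma> (I n)]" for \<sigma>])
     (use nml_subst [OF normal_modal_logic_K4I K4I_axioms(2)] in auto)

lemma sat_width_at:
  assumes "0 < n"
  shows "sat R V w (width_at n k) \<longleftrightarrow> sat R V w (reaches (Suc k)) \<or>
    sat R (\<lambda>i u. if i = 0 then V 0 u \<and> (\<forall>v. \<not> R u v)
                else if i = n then V n u \<and> sat R V u (reaches (k - 1))
                else V i u) w (I n)"
proof -
  have *: "(\<lambda>i u. sat R V u (if i = 0 then And (Atom 0) (Box Bot)
                 else if i = n then And (Atom n) (reaches (k - 1)) else Atom i)) =
        (\<lambda>i u. if i = 0 then V 0 u \<and> (\<forall>v. \<not> R u v)
                else if i = n then V n u \<and> sat R V u (reaches (k - 1)) else V i u)"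
    by (intro ext) auto
  show ?thesis
    unfolding width_at_def sat.simps(4) sat_subst * ..
qed

text \<open>
  A refutation at \<open>w\<close> needs successors \<open>u\<close> and \<open>y\<close> of \<open>w\<close>, where \<open>u\<close> is a dead end, \<open>y\<close> has
  height at least \<open>k - 1\<close> and \<open>y\<close> does not see \<open>u\<close>.  As \<open>w\<close> has height at most \<open>k\<close>, this leaves
  only \<open>w = Inl k\<close> and \<open>y = Inl (k - 1)\<close>; and a dead end seen by the former but not by the
  latter is one of the \<open>Inr j\<close>, and there \<open>m = k\<close> is forced.  The height \<open>k = 1\<close> is
  excluded because \<open>Inl (k - 1)\<close> would then itself be a dead end.
\<close>
lemma valid_width_at_iff:
  assumes "0 < n" "0 < m" "2 \<le> k"
  shows "valid (acc m) (width_at n k) \<longleftrightarrow> m \<noteq> k"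
proof
  assume valid: "valid (acc m) (width_at n k)"
  show "m \<noteq> k"
  proof
    assume "m = k"
    \<comment> \<open>The valuation names the members of an antichain of \<open>n + 1\<close> successors of \<open>Inl k\<close>.\<close>
    define V :: "nat \<Rightarrow> nat + nat \<Rightarrow> bool" where
      "V i u \<longleftrightarrow> u = (if i = n then Inl (k - 1) else Inr i)" for i u
    define W where "W = (\<lambda>i u. if i = 0 then V 0 u \<and> (\<forall>v. \<not> acc m u v)
                else if i = n then V n u \<and> sat (acc m) V u (reaches (k - 1)) else V i u)"
    have W: "W i u \<longleftrightarrow> V i u" for i u
      using assms by (auto simp: W_def V_def sat_reaches_Inl)
    have "sat (acc m) V (Inl k) (width_at n k)"
      using valid by (simp add: valid_def)
    then have "sat (acc m) W (Inl k) (I n)"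
      unfolding sat_width_at [OF assms(1)] W_def
      unfolding sat_reaches_Inl [OF assms(2)] by simp
    moreover have "\<exists>u. acc m (Inl k) u \<and> W i u" for i
      using assms \<open>m = k\<close> by (auto simp: W V_def)
    ultimately obtain i j u where "i \<noteq> j" "W i u" "W j u \<or> (\<exists>v. acc m u v \<and> W j v)"
      unfolding sat_I by blast
    then show False
      using assms \<open>m = k\<close> by (auto simp: W V_def split: if_splits)
  qed
next
  assume "m \<noteq> k"
  show "valid (acc m) (width_at n k)"
    unfolding valid_def
  proof (intro allI, rule ccontr)
    fix V w
    assume refuted: "\<not> sat (acc m) V w (width_at n k)"
    define W where "W = (\<lambda>i u. if i = 0 then V 0 u \<and> (\<forall>v. \<not> acc m u v)
                else if i = n then V n u \<and> sat (acc m) V u (reaches (k - 1)) else V i u)"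
    have low: "\<not> sat (acc m) V w (reaches (Suc k))" and not_I: "\<not> sat (acc m) W w (I n)"
      using refuted unfolding sat_width_at [OF assms(1)] W_def by blast+
    have premise: "\<exists>u. acc m w u \<and> W i u" if "i \<le> n" for i
      using not_I that unfolding sat_I not_imp by blast
    have antichain: "\<not> acc m y u" if "acc m w y" "W n y" "W 0 u" for u y
      using not_I that assms(1) unfolding sat_I not_imp by (metis le0 order_refl not_gr0)
    obtain u where u: "acc m w u" "W 0 u"
      using premise [of 0] by auto
    obtain y where y: "acc m w y" "W n y"
      using premise [of n] by auto
    have "sat (acc m) V y (reaches (k - 1))"
      using y(2) assms(1) by (simp add: W_def)
    then obtain b where b: "y = Inl b" "k - 1 \<le> b"
      using assms by (cases y) (auto simp: sat_reaches_Inl)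
    then obtain a where a: "w = Inl a" "a \<le> k"
      using low y(1) by (cases w) (auto simp: sat_reaches_Inl [OF assms(2)] simp del: funpow.simps)
    have "a = k" "b = k - 1"
      using y(1) a b by auto
    moreover have "\<not> acc m u (Inl 0)"
      using u(2) by (simp add: W_def)
    ultimately show False
      using u(1) antichain [OF y u(2)] a b assms \<open>m \<noteq> k\<close> by (cases u) auto
  qed
qed

section \<open>Counting the logics\<close>

instance fm :: countable
  by countable_datatype

definition logic_of :: "nat \<Rightarrow> nat set \<Rightarrow> fm set" where
  "logic_of n A = K4I n \<inter> (\<Inter>m\<in>A. {\<phi>. valid (acc m) \<phi>})"

lemma normal_modal_logic_logic_of: "normal_modal_logic (logic_of n A)"
proof -
  have "logic_of n A = \<Inter>(insert (K4I n) ((\<lambda>m. {\<phi>. valid (acc m) \<phi>}) ` A))"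
    by (simp add: logic_of_def)
  also have "normal_modal_logic \<dots>"
    using normal_modal_logic_K4I normal_modal_logic_valid
    by (intro normal_modal_logic_Inter) blast
  finally show ?thesis .
qed

lemma K4U_subset_logic_of:
  assumes "0 < n"
  shows "K4U n \<subseteq> logic_of n A"
  unfolding K4U_def
proof (rule smallest_nml_least [OF normal_modal_logic_logic_of])
  have "U n \<in> K4I n"
    using U_in_if_I_in normal_modal_logic_K4I K4I_axioms by blast
  then show "{axiom_4, U n} \<subseteq> logic_of n A"
    using K4U_axioms_valid_acc [OF assms] K4I_axioms by (simp add: logic_of_def)
qed

lemma width_at_in_logic_of_iff:
  assumes "0 < n" "2 \<le> k" "0 \<notin> A"
  shows "width_at n k \<in> logic_of n A \<longleftrightarrow> k \<notin> A"
proof -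
  have "valid (acc m) (width_at n k) \<longleftrightarrow> m \<noteq> k" if "m \<in> A" for m
    using that assms by (intro valid_width_at_iff) (auto intro: gr0I)
  then show ?thesis
    using width_at_in_K4I by (auto simp: logic_of_def)
qed

theorem mainTheorem6:
  fixes n :: nat
  assumes "0 < n"
  shows "{L. normal_modal_logic L \<and> K4U n \<subseteq> L \<and> L \<subseteq> K4I n} \<approx> (UNIV :: nat set set)"
    (is "?\<L> \<approx> _")
proof (rule lepoll_antisym)
  have "inj_on (\<lambda>L :: fm set. to_nat ` L) ?\<L>"
    by (intro inj_onI) (metis inj_image_eq_iff inj_to_nat)
  then show "?\<L> \<lesssim> (UNIV :: nat set set)"
    unfolding lepoll_def by blast
next
  \<comment> \<open>The shift by 2 provides the heights at which the formulas separate the frames.\<close>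
  let ?f = "\<lambda>A. logic_of n ((+) 2 ` A)"
  have "k \<in> A \<longleftrightarrow> width_at n (2 + k) \<notin> ?f A" for k A
    using width_at_in_logic_of_iff [OF assms, of "2 + k" "(+) 2 ` A"] by auto
  then have "inj ?f"
    by (intro injI) blast
  moreover have "logic_of n A \<subseteq> K4I n" for A
    by (simp add: logic_of_def)
  then have "range ?f \<subseteq> ?\<L>"
    using normal_modal_logic_logic_of K4U_subset_logic_of [OF assms] by blast
  ultimately show "(UNIV :: nat set set) \<lesssim> ?\<L>"
    unfolding lepoll_def by blast
qed

end
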